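(* Let $N$ be a set, let $F[N]$ be the free MV-algebra on $N$ generators, regarded as the MV-algebra of $[0,1]$-valued term functions on $[0,1]^N$, and let $I\subset F[N]$ be any ideal. Then the ideal of term functions vanishing on the common zero locus $V(I)\subset[0,1]^N$ of $I$ is the infradical of $I$, that is, $$J(V(I))=\sqrt{I}.$$ That is, if $f\in F[N]$ satisfies $f|_{V(I)}=0$, then $nf\ominus\neg f\in I$ for each integer $n\ge 0$.
   Context: In an MV-algebra $(A,\oplus,\neg,0)$ put $1=\neg 0$, $x\odot y=\neg(\neg x\oplus\neg y)$, $x\ominus y=x\odot\neg y$, $x\le y$ iff $x\ominus y=0$, and $na=a\oplus\cdots\oplus a$ ($n$ times, $0a=0$). An ideal is a subset containing $0$, closed under $\oplus$ and downward closed. The interval $[0,1]$ is an MV-algebra with $x\oplus y=\min(1,x+y)$, $\neg x=1-x$. $F[N]$ is the MV-algebra of terms in variables $\{x_i\}_{i\in N}$; by Chang's completeness theorem it is identified with the MV-algebra (pointwise operations) of term functions $[0,1]^N\to[0,1]$, i.e. the subalgebra of the algebra of continuous functions $[0,1]^N\to[0,1]$ generated by the coordinate projections $x_i$. For an ideal $I\subset F[N]$, $V(I)=\{x\in[0,1]^N\mid f(x)=0\ \forall f\in I\}$. For a closed $S\subset[0,1]^N$, $J(S)=\{f\in F[N]\mid f(x)=0\ \forall x\in S\}$. The infradical of an ideal $I$ of an MV-algebra $A$ is $\sqrt{I}=\{a\in A\mid na\ominus\neg a\in I\text{ for each integer }n\ge 0\}$ (the set of $I$-infinitesimal elements). *)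

theory Defs
  imports Complex_Main "HOL-Library.FuncSet" "HOL-Algebra.Congruence"
begin

record 'a mv = "'a partial_object" +
  mv_oplus :: "'a \<Rightarrow> 'a \<Rightarrow> 'a" (infixl "\<oplus>\<index>" 65)
  mv_neg :: "'a \<Rightarrow> 'a" ("\<sim>\<index> _" [81] 80)
  mv_zero :: 'a ("\<zero>\<index>")

locale mv_algebra =
  fixes A (structure)
  assumes oplus_closed: "x \<in> carrier A \<Longrightarrow> y \<in> carrier A \<Longrightarrow> x \<oplus> y \<in> carrier A"
    and neg_closed: "x \<in> carrier A \<Longrightarrow> \<sim> x \<in> carrier A"
    and zero_closed: "\<zero> \<in> carrier A"
    and oplus_assoc: "x \<in> carrier A \<Longrightarrow> y \<in> carrier A \<Longrightarrow> z \<in> carrier A \<Longrightarrow>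
          (x \<oplus> y) \<oplus> z = x \<oplus> (y \<oplus> z)"
    and oplus_comm: "x \<in> carrier A \<Longrightarrow> y \<in> carrier A \<Longrightarrow> x \<oplus> y = y \<oplus> x"
    and oplus_zero: "x \<in> carrier A \<Longrightarrow> x \<oplus> \<zero> = x"
    and neg_neg: "x \<in> carrier A \<Longrightarrow> \<sim> (\<sim> x) = x"
    and oplus_one: "x \<in> carrier A \<Longrightarrow> x \<oplus> \<sim> \<zero> = \<sim> \<zero>"
    and lukasiewicz: "x \<in> carrier A \<Longrightarrow> y \<in> carrier A \<Longrightarrow>
          \<sim> (\<sim> x \<oplus> y) \<oplus> y = \<sim> (\<sim> y \<oplus> x) \<oplus> x"

definition mv_odot :: "('a, 'b) mv_scheme \<Rightarrow> 'a \<Rightarrow> 'a \<Rightarrow> 'a" (infixl "\<odot>\<index>" 70)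
  where "x \<odot>\<^bsub>A\<^esub> y = \<sim>\<^bsub>A\<^esub> (\<sim>\<^bsub>A\<^esub> x \<oplus>\<^bsub>A\<^esub> \<sim>\<^bsub>A\<^esub> y)"

definition mv_ominus :: "('a, 'b) mv_scheme \<Rightarrow> 'a \<Rightarrow> 'a \<Rightarrow> 'a" (infixl "\<ominus>\<index>" 65)
  where "x \<ominus>\<^bsub>A\<^esub> y = x \<odot>\<^bsub>A\<^esub> \<sim>\<^bsub>A\<^esub> y"

definition mv_le :: "('a, 'b) mv_scheme \<Rightarrow> 'a \<Rightarrow> 'a \<Rightarrow> bool" (infix "\<preceq>\<index>" 50)
  where "x \<preceq>\<^bsub>A\<^esub> y \<longleftrightarrow> x \<ominus>\<^bsub>A\<^esub> y = \<zero>\<^bsub>A\<^esub>"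

primrec mv_mult :: "('a, 'b) mv_scheme \<Rightarrow> nat \<Rightarrow> 'a \<Rightarrow> 'a" where
  "mv_mult A 0 a = \<zero>\<^bsub>A\<^esub>"
| "mv_mult A (Suc n) a = a \<oplus>\<^bsub>A\<^esub> mv_mult A n a"

definition mv_ideal :: "('a, 'b) mv_scheme \<Rightarrow> 'a set \<Rightarrow> bool" where
  "mv_ideal A I \<longleftrightarrow> I \<subseteq> carrier A \<and> \<zero>\<^bsub>A\<^esub> \<in> I
     \<and> (\<forall>x\<in>I. \<forall>y\<in>I. x \<oplus>\<^bsub>A\<^esub> y \<in> I)
     \<and> (\<forall>y\<in>I. \<forall>x\<in>carrier A. x \<preceq>\<^bsub>A\<^esub> y \<longrightarrow> x \<in> I)"

definition infradical :: "('a, 'b) mv_scheme \<Rightarrow> 'a set \<Rightarrow> 'a set" where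
  "infradical A I = {a \<in> carrier A. \<forall>n. mv_mult A n a \<ominus>\<^bsub>A\<^esub> \<sim>\<^bsub>A\<^esub> a \<in> I}"

definition unit_mv :: "real mv" where
  "unit_mv = \<lparr>carrier = {0..1}, mv_oplus = (\<lambda>x y. min 1 (x + y)), mv_neg = (\<lambda>x. 1 - x),
     mv_zero = 0\<rparr>"

text \<open>Functions on \<open>X\<close> are represented extensionally (\<open>undefined\<close> off \<open>X\<close>), so
  that equality in \<open>pointwise_mv X A\<close> is equality of functions on \<open>X\<close>.\<close>

definition pointwise_mv :: "'x set \<Rightarrow> ('a, 'b) mv_scheme \<Rightarrow> ('x \<Rightarrow> 'a) mv" where
  "pointwise_mv X A =
     \<lparr>carrier = X \<rightarrow>\<^sub>E carrier A,
      mv_oplus = (\<lambda>f g. \<lambda>x\<in>X. f x \<oplus>\<^bsub>A\<^esub> g x),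
      mv_neg = (\<lambda>f. \<lambda>x\<in>X. \<sim>\<^bsub>A\<^esub> f x),
      mv_zero = (\<lambda>x\<in>X. \<zero>\<^bsub>A\<^esub>)\<rparr>"

inductive_set subalgebra_generated :: "('a, 'b) mv_scheme \<Rightarrow> 'a set \<Rightarrow> 'a set"
  for A G where
  generator: "g \<in> G \<Longrightarrow> g \<in> subalgebra_generated A G"
| zero: "\<zero>\<^bsub>A\<^esub> \<in> subalgebra_generated A G"
| neg: "x \<in> subalgebra_generated A G \<Longrightarrow> \<sim>\<^bsub>A\<^esub> x \<in> subalgebra_generated A G"
| oplus: "x \<in> subalgebra_generated A G \<Longrightarrow> y \<in> subalgebra_generated A G \<Longrightarrow>
    x \<oplus>\<^bsub>A\<^esub> y \<in> subalgebra_generated A G"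

definition cube :: "'n set \<Rightarrow> ('n \<Rightarrow> real) set" where
  "cube N = N \<rightarrow>\<^sub>E {0..1}"

definition coord :: "'n set \<Rightarrow> 'n \<Rightarrow> ('n \<Rightarrow> real) \<Rightarrow> real" where
  "coord N i = (\<lambda>x\<in>cube N. x i)"

text \<open>The free MV-algebra \<open>F[N]\<close>, in its representation by term functions. Term functions
  are automatically continuous, so the algebra of all functions can serve as the ambient
  algebra in which the coordinate projections generate.\<close>

definition free_mv :: "'n set \<Rightarrow> (('n \<Rightarrow> real) \<Rightarrow> real) mv" where
  "free_mv N = (pointwise_mv (cube N) unit_mv)
     \<lparr>carrier := subalgebra_generated (pointwise_mv (cube N) unit_mv) (coord N ` N)\<rparr>"

definition zero_locus :: "'n set \<Rightarrow> (('n \<Rightarrow> real) \<Rightarrow> real) set \<Rightarrow> ('n \<Rightarrow> real) set" where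
  "zero_locus N I = {x \<in> cube N. \<forall>f\<in>I. f x = 0}"

definition vanishing_ideal :: "'n set \<Rightarrow> ('n \<Rightarrow> real) set \<Rightarrow> (('n \<Rightarrow> real) \<Rightarrow> real) set" where
  "vanishing_ideal N S = {f \<in> carrier (free_mv N). \<forall>x\<in>S. f x = 0}"

lemma unit_mv_algebra: "mv_algebra unit_mv"
  by unfold_locales (auto simp: unit_mv_def min_def)

lemma pointwise_mv_algebra:
  assumes "mv_algebra A"
  shows "mv_algebra (pointwise_mv X A)"
proof -
  interpret mv_algebra A by fact
  have mem: "f x \<in> carrier A" if "f \<in> X \<rightarrow>\<^sub>E carrier A" "x \<in> X" for f x
    using that by (rule PiE_mem)
  have ext: "(\<lambda>x\<in>X. h x) = f" if "f \<in> X \<rightarrow>\<^sub>E carrier A" "\<And>x. x \<in> X \<Longrightarrow> h x = f x" for f h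
  proof
    fix x
    show "(\<lambda>x\<in>X. h x) x = f x"
      using that(2)[of x] PiE_arb[OF that(1), of x] by (cases "x \<in> X") simp_all
  qed
  show ?thesis
    unfolding pointwise_mv_def
    apply (rule mv_algebra.intro; simp)
            apply (simp add: mem oplus_closed)
           apply (simp add: mem neg_closed)
          apply (simp add: zero_closed)
         apply (rule restrict_ext, simp add: mem oplus_assoc)
        apply (rule restrict_ext, simp add: mem oplus_comm)
       apply (rule ext, assumption, simp add: mem oplus_zero)
      apply (rule ext, assumption, simp add: mem neg_neg)
     apply (rule restrict_ext, simp add: mem oplus_one)
    apply (rule restrict_ext, simp add: mem lukasiewicz)
    done
qed

lemma free_mv_carrier_subset: "carrier (free_mv N) \<subseteq> cube N \<rightarrow>\<^sub>E {0..1}"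
proof -
  interpret mv_algebra "pointwise_mv (cube N) unit_mv"
    by (intro pointwise_mv_algebra unit_mv_algebra)
  have "f \<in> carrier (pointwise_mv (cube N) unit_mv)"
    if "f \<in> subalgebra_generated (pointwise_mv (cube N) unit_mv) (coord N ` N)" for f
    using that
  proof induction
    case (generator g)
    then show ?case
      by (auto simp: pointwise_mv_def unit_mv_def coord_def cube_def PiE_iff)
  qed (auto intro: oplus_closed neg_closed zero_closed)
  then show ?thesis
    by (auto simp: free_mv_def pointwise_mv_def unit_mv_def)
qed

lemma free_mv_algebra: "mv_algebra (free_mv N)"
proof -
  let ?P = "pointwise_mv (cube N) unit_mv"
  let ?S = "subalgebra_generated ?P (coord N ` N)"
  interpret mv_algebra ?P
    by (intro pointwise_mv_algebra unit_mv_algebra)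
  have *: "x \<in> carrier ?P" if "x \<in> ?S" for x
    using that free_mv_carrier_subset[of N]
    by (simp add: free_mv_def pointwise_mv_def unit_mv_def subset_iff)
  have ops: "carrier (free_mv N) = ?S" "mv_oplus (free_mv N) = mv_oplus ?P"
      "mv_neg (free_mv N) = mv_neg ?P" "mv_zero (free_mv N) = mv_zero ?P"
    by (simp_all add: free_mv_def)
  show ?thesis
  proof (rule mv_algebra.intro, unfold ops)
    fix x y z
    assume x: "x \<in> ?S"
    show "x \<oplus>\<^bsub>?P\<^esub> \<zero>\<^bsub>?P\<^esub> = x" by (rule oplus_zero[OF *[OF x]])
    show "\<sim>\<^bsub>?P\<^esub> (\<sim>\<^bsub>?P\<^esub> x) = x" by (rule neg_neg[OF *[OF x]])
    show "x \<oplus>\<^bsub>?P\<^esub> \<sim>\<^bsub>?P\<^esub> \<zero>\<^bsub>?P\<^esub> = \<sim>\<^bsub>?P\<^esub> \<zero>\<^bsub>?P\<^esub>" by (rule oplus_one[OF *[OF x]])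
    show "\<sim>\<^bsub>?P\<^esub> x \<in> ?S" by (rule subalgebra_generated.neg[OF x])
    assume y: "y \<in> ?S"
    show "x \<oplus>\<^bsub>?P\<^esub> y \<in> ?S" by (rule subalgebra_generated.oplus[OF x y])
    show "x \<oplus>\<^bsub>?P\<^esub> y = y \<oplus>\<^bsub>?P\<^esub> x" by (rule oplus_comm[OF *[OF x] *[OF y]])
    show "\<sim>\<^bsub>?P\<^esub> (\<sim>\<^bsub>?P\<^esub> x \<oplus>\<^bsub>?P\<^esub> y) \<oplus>\<^bsub>?P\<^esub> y = \<sim>\<^bsub>?P\<^esub> (\<sim>\<^bsub>?P\<^esub> y \<oplus>\<^bsub>?P\<^esub> x) \<oplus>\<^bsub>?P\<^esub> x"
      by (rule lukasiewicz[OF *[OF x] *[OF y]])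
    assume z: "z \<in> ?S"
    show "x \<oplus>\<^bsub>?P\<^esub> y \<oplus>\<^bsub>?P\<^esub> z = x \<oplus>\<^bsub>?P\<^esub> (y \<oplus>\<^bsub>?P\<^esub> z)"
      by (rule oplus_assoc[OF *[OF x] *[OF y] *[OF z]])
  qed (rule subalgebra_generated.zero)
qed

lemma vanishing_ideal_is_ideal:
  assumes "S \<subseteq> cube N"
  shows "mv_ideal (free_mv N) (vanishing_ideal N S)"
proof -
  interpret mv_algebra "free_mv N" by (rule free_mv_algebra)
  have ops: "(\<zero>\<^bsub>free_mv N\<^esub>) x = 0"
      "(f \<oplus>\<^bsub>free_mv N\<^esub> g) x = min 1 (f x + g x)"
      "(f \<ominus>\<^bsub>free_mv N\<^esub> g) x = 1 - min 1 (1 - f x + (1 - (1 - g x)))"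
    if "x \<in> S" for f g x
    using assms that
    by (simp_all add: subset_iff mv_ominus_def mv_odot_def free_mv_def pointwise_mv_def
        unit_mv_def)
  have below: "f x = 0"
    if "f \<in> carrier (free_mv N)" "f \<preceq>\<^bsub>free_mv N\<^esub> g" "x \<in> S" "g x = 0" for f g x
  proof -
    have "f \<in> cube N \<rightarrow>\<^sub>E {0..1}" "x \<in> cube N"
      using that(1,3) assms free_mv_carrier_subset by blast+
    then have "f x \<in> {0..1}"
      by (rule PiE_mem)
    moreover have "(f \<ominus>\<^bsub>free_mv N\<^esub> g) x = 0"
      using that ops(1) by (simp add: mv_le_def)
    ultimately show ?thesis
      using ops(3)[OF that(3), of f g] that(4) by simp
  qed
  show ?thesis
    unfolding mv_ideal_def
  proof (intro conjI ballI impI)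
    show "vanishing_ideal N S \<subseteq> carrier (free_mv N)"
      by (auto simp: vanishing_ideal_def)
    show "\<zero>\<^bsub>free_mv N\<^esub> \<in> vanishing_ideal N S"
      by (simp add: vanishing_ideal_def zero_closed ops)
  next
    fix f g
    assume "f \<in> vanishing_ideal N S" "g \<in> vanishing_ideal N S"
    then show "f \<oplus>\<^bsub>free_mv N\<^esub> g \<in> vanishing_ideal N S"
      by (simp add: vanishing_ideal_def oplus_closed ops)
  next
    fix f g
    assume "g \<in> vanishing_ideal N S" "f \<in> carrier (free_mv N)" "f \<preceq>\<^bsub>free_mv N\<^esub> g"
    then show "f \<in> vanishing_ideal N S"
      by (simp add: vanishing_ideal_def below)
  qed
qed

end

theory Submission
  imports Defs "HOL-Analysis.Function_Topology"
begin

text \<open>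
  If \<open>f\<close> vanishes on \<open>V(I)\<close>, then \<open>nf \<ominus> \<not>f\<close> vanishes off the compact set
  \<open>K = {f \<ge> 1/(n+1)}\<close>, which does not meet \<open>V(I)\<close>. By compactness some finite sum \<open>g\<close> of
  members of \<open>I\<close> is positive on \<open>K\<close>, hence bounded below there, so that some multiple \<open>mg\<close>
  equals \<open>1\<close> on \<open>K\<close> and dominates \<open>nf \<ominus> \<not>f\<close>. Conversely, for \<open>f(x) > 0\<close> and \<open>n \<ge> 1/f(x)\<close>
  one has \<open>(nf \<ominus> \<not>f)(x) = f(x)\<close>.
\<close>

text \<open>Points of the cube are extensional, hence constantly \<open>undefined\<close> off
  \<open>N\<close>. With a singleton factor at each such index the cube becomes a product over the
  whole index type, so Tychonoff and the closedness criterion for products apply in the topology of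
  the function type.\<close>

lemma cube_eq_PiE_UNIV: "cube N = (\<Pi>\<^sub>E i\<in>UNIV. if i \<in> N then {0..1} else {undefined})"
proof (rule Set.set_eqI)
  fix x :: "'a \<Rightarrow> real"
  have "x \<in> cube N \<longleftrightarrow> (\<forall>i. x i \<in> (if i \<in> N then {0..1} else {undefined}))"
    unfolding cube_def PiE_iff extensional_def by auto
  then show "x \<in> cube N \<longleftrightarrow> x \<in> (\<Pi>\<^sub>E i\<in>UNIV. if i \<in> N then {0..1} else {undefined})"
    by (simp add: PiE_iff)
qed

lemma compact_cube: "compact (cube N)"
proof -
  have "compactin (product_topology (\<lambda>i. euclidean) UNIV) (cube N)"
    unfolding cube_eq_PiE_UNIV by (simp add: compactin_PiE)
  then show ?thesis
    by (simp add: euclidean_product_topology)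
qed

lemma closed_cube: "closed (cube N)"
proof -
  have "closedin (product_topology (\<lambda>i. euclidean) UNIV) (cube N)"
    unfolding cube_eq_PiE_UNIV by (simp add: closedin_product_topology)
  then show ?thesis
    by (simp add: euclidean_product_topology)
qed

lemma free_mv_apply:
  assumes "x \<in> cube N"
  shows "(\<zero>\<^bsub>free_mv N\<^esub>) x = 0"
    and "(f \<oplus>\<^bsub>free_mv N\<^esub> g) x = min 1 (f x + g x)"
    and "(\<sim>\<^bsub>free_mv N\<^esub> f) x = 1 - f x"
    and "(f \<ominus>\<^bsub>free_mv N\<^esub> g) x = max 0 (f x - g x)"
  using assms
  by (simp_all add: mv_ominus_def mv_odot_def free_mv_def pointwise_mv_def unit_mv_def min_def max_def)

lemma free_mv_range:
  assumes "f \<in> carrier (free_mv N)" "x \<in> cube N"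
  shows "0 \<le> f x" "f x \<le> 1"
  using PiE_mem[of f "cube N" "\<lambda>_. {0..1}" x] assms free_mv_carrier_subset[of N] by auto

text \<open>The order is an equation between functions, both of which are restricted to the cube, so
  it only has to be tested at points of the cube.\<close>

lemma free_mv_le_iff:
  assumes "f \<in> carrier (free_mv N)" "g \<in> carrier (free_mv N)"
  shows "f \<preceq>\<^bsub>free_mv N\<^esub> g \<longleftrightarrow> (\<forall>x\<in>cube N. f x \<le> g x)"
proof -
  have "f \<ominus>\<^bsub>free_mv N\<^esub> g = (\<lambda>x\<in>cube N. max 0 (f x - g x))"
    by (rule ext) (simp add: mv_ominus_def mv_odot_def free_mv_def pointwise_mv_def unit_mv_def min_def max_def)
  moreover have "\<zero>\<^bsub>free_mv N\<^esub> = (\<lambda>x\<in>cube N. 0)"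
    by (simp add: free_mv_def pointwise_mv_def unit_mv_def)
  ultimately have "f \<preceq>\<^bsub>free_mv N\<^esub> g \<longleftrightarrow> (\<forall>x\<in>cube N. max 0 (f x - g x) = 0)"
    by (auto simp: mv_le_def fun_eq_iff)
  moreover have "max 0 (a - b) = 0 \<longleftrightarrow> a \<le> b" for a b :: real
    by linarith
  ultimately show ?thesis
    by simp
qed

text \<open>As \<open>f x\<close> is nonnegative, truncating at 1 after every summand amounts to
  truncating once at the end.\<close>

lemma mv_mult_apply:
  assumes "f \<in> carrier (free_mv N)" "x \<in> cube N"
  shows "mv_mult (free_mv N) n f x = min 1 (real n * f x)"
  by (induction n) (use free_mv_range[OF assms] in \<open>auto simp: free_mv_apply[OF assms(2)] algebra_simps min_def\<close>)

lemma (in mv_algebra) mv_mult_closed: "a \<in> carrier A \<Longrightarrow> mv_mult A n a \<in> carrier A"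
  by (induction n) (simp_all add: zero_closed oplus_closed)

lemma (in mv_algebra) ominus_closed:
  "a \<in> carrier A \<Longrightarrow> b \<in> carrier A \<Longrightarrow> a \<ominus> b \<in> carrier A"
  by (simp add: mv_ominus_def mv_odot_def neg_closed oplus_closed)

lemma mv_ideal_mult: "mv_ideal A I \<Longrightarrow> a \<in> I \<Longrightarrow> mv_mult A n a \<in> I"
  by (induction n) (simp_all add: mv_ideal_def)

text \<open>Induction on the generation of term functions: projections are continuous in the product
  topology, and the operations preserve continuity. The congruence rule strips the restriction to
  the cube.\<close>

lemma free_mv_continuous:
  assumes "f \<in> carrier (free_mv N)"
  shows "continuous_on (cube N) f"
proof -
  let ?P = "pointwise_mv (cube N) unit_mv"
  have "f \<in> subalgebra_generated ?P (coord N ` N)"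
    using assms by (simp add: free_mv_def)
  then show ?thesis
  proof induction
    case (generator g)
    then obtain i where "g = coord N i"
      by auto
    moreover have "continuous_on (cube N) (\<lambda>x. x i)"
      by (rule continuous_on_product_coordinates[THEN continuous_on_subset]) simp
    ultimately show ?case
      by (simp add: coord_def cong: continuous_on_cong)
  next
    case zero
    then show ?case
      by (simp add: pointwise_mv_def unit_mv_def cong: continuous_on_cong)
  next
    case (neg f)
    then show ?case
      by (simp add: pointwise_mv_def unit_mv_def continuous_intros cong: continuous_on_cong)
  next
    case (oplus f g)
    then show ?case
      by (simp add: pointwise_mv_def unit_mv_def continuous_intros cong: continuous_on_cong)
  qed
qed

text \<open>The sum of the members of \<open>G\<close> serves as \<open>h\<close>: its terms are
  nonnegative, and truncation at 1 is harmless because no member exceeds 1.\<close>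

lemma ideal_dominates_finite:
  assumes I: "mv_ideal (free_mv N) I" and "finite G" "G \<subseteq> I"
  shows "\<exists>h\<in>I. \<forall>g\<in>G. \<forall>x\<in>cube N. g x \<le> h x"
  using \<open>finite G\<close> \<open>G \<subseteq> I\<close>
proof (induction G rule: finite_induct)
  case empty
  then show ?case
    using I by (auto simp: mv_ideal_def)
next
  case (insert g G)
  then obtain h where h: "h \<in> I" "\<forall>g\<in>G. \<forall>x\<in>cube N. g x \<le> h x" and g: "g \<in> I"
    by auto
  have carrier: "k \<in> carrier (free_mv N)" if "k \<in> I" for k
    using I that by (auto simp: mv_ideal_def)
  have "\<forall>k\<in>insert g G. \<forall>x\<in>cube N. k x \<le> (g \<oplus>\<^bsub>free_mv N\<^esub> h) x"
  proof (intro ballI)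
    fix k x
    assume k: "k \<in> insert g G" and x: "x \<in> cube N"
    then have "k x \<le> 1" "0 \<le> g x" "0 \<le> h x"
      using insert.prems g h(1) by (auto intro: free_mv_range carrier)
    then show "k x \<le> (g \<oplus>\<^bsub>free_mv N\<^esub> h) x"
      using k h(2) x by (fastforce simp: free_mv_apply)
  qed
  moreover have "g \<oplus>\<^bsub>free_mv N\<^esub> h \<in> I"
    using I g h(1) by (simp add: mv_ideal_def)
  ultimately show ?case
    by blast
qed

text \<open>This is the compactness argument in reusable form. Since 1 is the top value, such an
  \<open>h\<close> dominates every term function on \<open>K\<close>.\<close>

lemma ideal_eq_one_on_closed:
  assumes I: "mv_ideal (free_mv N) I"
    and K: "closed K" "K \<subseteq> cube N" "K \<inter> zero_locus N I = {}"
  shows "\<exists>h\<in>I. \<forall>x\<in>K. h x = 1"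
proof -
  have carrier: "g \<in> carrier (free_mv N)" if "g \<in> I" for g
    using I that by (auto simp: mv_ideal_def)
  have "compact K"
    using compact_Int_closed[OF compact_cube K(1), of N] K(2) by (simp add: Int_absorb1)
  \<comment> \<open>For \<open>g\<close> in \<open>I\<close> this is the zero set of
    \<open>g\<close> in \<open>K\<close>, as values are nonnegative; the inequality presents it as
    the preimage of a closed ray.\<close>
  define Z where "Z g = {x \<in> K. g x \<le> 0}" for g :: "('a \<Rightarrow> real) \<Rightarrow> real"
  have "closed (Z g)" if "g \<in> I" for g
  proof -
    have "continuous_on K g"
      using free_mv_continuous[OF carrier[OF that]] K(2) by (rule continuous_on_subset)
    from continuous_closed_preimage[OF this K(1) closed_atMost[of 0]]
    show ?thesis
      by (simp add: Z_def vimage_def Int_def)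
  qed
  moreover have "K \<inter> \<Inter> (Z ` I) = {}"
  proof -
    have "x \<in> zero_locus N I" if "x \<in> K" "\<And>g. g \<in> I \<Longrightarrow> g x \<le> 0" for x
    proof -
      have "x \<in> cube N"
        using that(1) K(2) by blast
      then show ?thesis
        using that(2) free_mv_range(1)[OF carrier] by (force simp: zero_locus_def)
    qed
    then show ?thesis
      using K(3) by (auto simp: Z_def)
  qed
  ultimately obtain F where F: "finite F" "F \<subseteq> Z ` I" "K \<inter> \<Inter> F = {}"
    using compact_imp_fip[OF \<open>compact K\<close>, of "Z ` I"] by blast
  obtain G where G: "G \<subseteq> I" "finite G" "F = Z ` G"
    using finite_subset_image[OF F(1,2)] by blast
  obtain h where h: "h \<in> I" "\<forall>g\<in>G. \<forall>x\<in>cube N. g x \<le> h x"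
    using ideal_dominates_finite[OF I G(2,1)] by blast
  have pos: "h x > 0" if x: "x \<in> K" for x
  proof -
    have "x \<notin> \<Inter> F"
      using F(3) x by blast
    then obtain g where "g \<in> G" "g x > 0"
      using x by (auto simp: G(3) Z_def not_le)
    then show ?thesis
      using h(2) x K(2) by force
  qed
  \<comment> \<open>A positive minimum of \<open>h\<close> is attained only on nonempty
    \<open>K\<close>; for empty \<open>K\<close> any positive constant will do.\<close>
  obtain e where e: "e > 0" "\<And>x. x \<in> K \<Longrightarrow> e \<le> h x"
  proof (cases "K = {}")
    case True
    then show ?thesis
      using that[of 1] by simp
  next
    case False
    have "continuous_on K h"
      using free_mv_continuous[OF carrier[OF h(1)]] K(2) by (rule continuous_on_subset)
    from continuous_attains_inf[OF \<open>compact K\<close> False this] show ?thesis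
      using that pos by blast
  qed
  obtain m where m: "1 < real m * e"
    using reals_Archimedean3[OF e(1)] by blast
  have "mv_mult (free_mv N) m h x = 1" if "x \<in> K" for x
  proof -
    have "x \<in> cube N"
      using that K(2) by blast
    moreover have "real m * e \<le> real m * h x"
      by (simp add: e(2) that mult_left_mono)
    ultimately show ?thesis
      using m by (simp add: mv_mult_apply[OF carrier[OF h(1)]])
  qed
  then show ?thesis
    using mv_ideal_mult[OF I h(1)] by blast
qed

theorem theorem3p11:
  fixes N :: "'n set" and I :: "(('n \<Rightarrow> real) \<Rightarrow> real) set"
  assumes "mv_ideal (free_mv N) I"
  shows "vanishing_ideal N (zero_locus N I) = infradical (free_mv N) I"
proof -
  interpret mv_algebra "free_mv N"
    by (rule free_mv_algebra)
  \<comment> \<open>At a point of the cube this value is positive exactly when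
    \<open>(n + 1) * f x > 1\<close>, and it equals \<open>f x\<close> once
    \<open>n * f x \<ge> 1\<close>. The two inclusions rest on these two facts.\<close>
  have apply_neg: "(mv_mult (free_mv N) n f \<ominus>\<^bsub>free_mv N\<^esub> \<sim>\<^bsub>free_mv N\<^esub> f) x
      = max 0 (min 1 (real n * f x) + f x - 1)"
    if "f \<in> carrier (free_mv N)" "x \<in> cube N" for n f x
    by (simp add: free_mv_apply that mv_mult_apply algebra_simps)
  show ?thesis
  proof (intro equalityI subsetI)
    fix f
    assume "f \<in> vanishing_ideal N (zero_locus N I)"
    then have f: "f \<in> carrier (free_mv N)" and f0: "\<And>x. x \<in> zero_locus N I \<Longrightarrow> f x = 0"
      by (auto simp: vanishing_ideal_def)
    have "mv_mult (free_mv N) n f \<ominus>\<^bsub>free_mv N\<^esub> \<sim>\<^bsub>free_mv N\<^esub> f \<in> I" for n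
    proof -
      let ?u = "mv_mult (free_mv N) n f \<ominus>\<^bsub>free_mv N\<^esub> \<sim>\<^bsub>free_mv N\<^esub> f"
      \<comment> \<open>The weak inequality makes \<open>K\<close> closed, while \<open>K\<close>
        still contains every point where \<open>?u\<close> is positive.\<close>
      define K where "K = {x \<in> cube N. 1 \<le> (real n + 1) * f x}"
      have "closed K"
      proof -
        have "continuous_on (cube N) (\<lambda>x. (real n + 1) * f x)"
          by (intro continuous_intros free_mv_continuous f)
        from continuous_closed_preimage[OF this closed_cube closed_atLeast[of 1]]
        show ?thesis
          by (simp add: K_def vimage_def Int_def)
      qed
      moreover have "K \<inter> zero_locus N I = {}" "K \<subseteq> cube N"
        using f0 by (auto simp: K_def)
      ultimately obtain h where h: "h \<in> I" "\<And>x. x \<in> K \<Longrightarrow> h x = 1"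
        using ideal_eq_one_on_closed[OF assms, of K] by blast
      have hc: "h \<in> carrier (free_mv N)"
        using assms h(1) by (auto simp: mv_ideal_def)
      have u: "?u \<in> carrier (free_mv N)"
        by (intro ominus_closed mv_mult_closed neg_closed f)
      have "?u x \<le> h x" if x: "x \<in> cube N" for x
      proof (cases "x \<in> K")
        case True
        then show ?thesis
          using h(2) free_mv_range(2)[OF u x] by simp
      next
        case False
        then have "real n * f x + f x < 1"
          using x by (simp add: K_def algebra_simps)
        then have "?u x = 0"
          by (simp add: apply_neg[OF f x])
        then show ?thesis
          using free_mv_range(1)[OF hc x] by simp
      qed
      then have "?u \<preceq>\<^bsub>free_mv N\<^esub> h"
        by (simp add: free_mv_le_iff[OF u hc])
      then show ?thesis
        using assms h(1) u unfolding mv_ideal_def by blast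
    qed
    with f show "f \<in> infradical (free_mv N) I"
      by (simp add: infradical_def)
  next
    fix f
    assume "f \<in> infradical (free_mv N) I"
    then have f: "f \<in> carrier (free_mv N)"
      and u: "\<And>n. mv_mult (free_mv N) n f \<ominus>\<^bsub>free_mv N\<^esub> \<sim>\<^bsub>free_mv N\<^esub> f \<in> I"
      by (auto simp: infradical_def)
    have "f x = 0" if x: "x \<in> zero_locus N I" for x
    proof (rule ccontr)
      have xc: "x \<in> cube N"
        using x by (simp add: zero_locus_def)
      assume "f x \<noteq> 0"
      then have pos: "f x > 0"
        using free_mv_range(1)[OF f xc] by simp
      \<comment> \<open>For this \<open>n\<close> the multiple is truncated to 1 at
        \<open>x\<close>, so the difference takes the value \<open>f x > 0\<close> there, although
        it lies in \<open>I\<close> and \<open>x\<close> is a common zero of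
        \<open>I\<close>.\<close>
      then obtain n where n: "1 < real n * f x"
        using reals_Archimedean3 by blast
      have "(mv_mult (free_mv N) n f \<ominus>\<^bsub>free_mv N\<^esub> \<sim>\<^bsub>free_mv N\<^esub> f) x = 0"
        using x u[of n] by (simp add: zero_locus_def)
      then show False
        using n pos by (simp add: apply_neg[OF f xc])
    qed
    with f show "f \<in> vanishing_ideal N (zero_locus N I)"
      by (simp add: vanishing_ideal_def)
  qed
qed

end
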